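(* Let $p$ be an odd prime and let $k$ be an integer with $1\le k\le p$. Let $Q$ be a sequence over $\mathbb F_p^2\setminus\{0\}$ such that $$|Q|=2p+k-2,\qquad |Q\cap L|\le p+k-2\quad\text{for every line } L\le \mathbb F_p^2.$$ Then $Q$ contains a mixed zero-sum block $U$ satisfying $$|\Omega(U)|\ge k.$$
   Context: A sequence over a set of vectors is a finite unordered list of such vectors, with repetitions allowed (a finite multiset); $|Q|$ is its length, counting multiplicity. A line is a one-dimensional linear subspace of $\mathbb F_p^2$, and $Q\cap L$ is the subsequence of those terms of $Q$ (with multiplicity) lying on $L$. A zero-sum block of $Q$ is a nonempty subsequence of $Q$ whose terms sum to $0$. A sequence is collinear if all its terms lie on a one-dimensional subspace, and mixed otherwise. Write a vector as $u=(a(u),b(u))$. For an ordering $I=(u_1,\dots,u_n)$ of a sequence put $q(I)=\sum_{i<j}a(u_i)b(u_j)\in\mathbb F_p$; for a sequence $U$, $\Omega(U)=\{q(I): I\text{ is an ordering of }U\}\subseteq\mathbb F_p$. *)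

theory Defs
  imports
    "HOL-Analysis.Cartesian_Space"
    "HOL-Combinatorics.Multiset_Permutations"
    "Berlekamp_Zassenhaus.Finite_Field"
begin

text \<open>
  The prime field with p elements is \<open>'p mod_ring\<close> for an index type of class
  \<open>prime_card\<close> with \<open>CARD('p) = p\<close>. The plane over it is \<open>'p mod_ring ^ 2\<close>, so the
  coordinates of a vector \<open>u\<close> are \<open>u $ 1\<close> and \<open>u $ 2\<close>. A sequence (finite, unordered,
  repetitions allowed) is a multiset.
\<close>

definition is_line :: "('a::field ^ 2) set \<Rightarrow> bool" where
  "is_line L \<longleftrightarrow> vec.subspace L \<and> vec.dim L = 1"

definition restrict_seq :: "'v multiset \<Rightarrow> 'v set \<Rightarrow> 'v multiset" where
  "restrict_seq Q L = {#u \<in># Q. u \<in> L#}"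

definition zero_sum_block :: "'v::comm_monoid_add multiset \<Rightarrow> 'v multiset \<Rightarrow> bool" where
  "zero_sum_block Q U \<longleftrightarrow> U \<subseteq># Q \<and> U \<noteq> {#} \<and> \<Sum>\<^sub># U = 0"

definition collinear_seq :: "('a::field ^ 2) multiset \<Rightarrow> bool" where
  "collinear_seq U \<longleftrightarrow> (\<exists>L. is_line L \<and> set_mset U \<subseteq> L)"

definition mixed_seq :: "('a::field ^ 2) multiset \<Rightarrow> bool" where
  "mixed_seq U \<longleftrightarrow> \<not> collinear_seq U"

definition q_ord :: "('a::field ^ 2) list \<Rightarrow> 'a" where
  "q_ord I = (\<Sum>j<length I. \<Sum>i<j. (I ! i) $ 1 * (I ! j) $ 2)"

definition Omega :: "('a::field ^ 2) multiset \<Rightarrow> 'a set" where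
  "Omega U = q_ord ` permutations_of_multiset U"

end

theory Submission
  imports Defs
begin

text \<open>
  Two independent facts are combined. Write \<open>\<sigma>\<close> for sums and \<open>det2\<close> for the determinant of two
  vectors.

  The first fact is that long blocks have many order values: a mixed zero-sum block \<open>U\<close> of
  nonzero vectors satisfies \<open>\<bar>\<Omega>(U)\<bar> \<ge> min p (\<bar>U\<bar> - 1)\<close>. Build \<open>U\<close> up one vector at a time. Putting
  the new vector \<open>w\<close> at the front or at the back of an ordering of \<open>P\<close> changes \<open>q\<close> by two
  amounts whose difference is \<open>det2 (\<sigma> P) w\<close>. If this is not zero, \<open>\<Omega>\<close> is replaced by a superset
  of the union of two different translates, and in a group of prime order that union is larger by
  at least one unless it is everything. The vectors of \<open>U\<close> can be ordered so that only the first and the last of them are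
  parallel to the preceding partial sum; this is \<open>card_Omega_zero_sum\<close>.

  The second fact is that \<open>Q\<close> has a mixed zero-sum block of length at least \<open>k + 1\<close>. Its engine
  is the polynomial method on a cube: the alternating sum over all subsets of an \<open>n\<close>-set of a
  product of fewer than \<open>n\<close> affine forms is zero, so such a product, if nonzero at the empty set,
  is nonzero at some other subset. With forms chosen to enforce a sum on a line \<open>L\<close> and in a
  prescribed subset of \<open>L\<close>, and a lower bound on the length, this gives
  \<open>compensated_subsequence\<close>: terms off \<open>L\<close> can be exchanged against a given subsequence of the
  terms on \<open>L\<close>.

  If some line \<open>L\<close> carries at least \<open>p\<close> terms, then \<open>p - 1\<close> of these already have every
  point of \<open>L\<close> as a subset sum. They balance at the same time the remaining terms on \<open>L\<close> and a
  long choice of terms off \<open>L\<close>, and everything except these \<open>p - 1\<close> terms counts towards the length.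

  If every line carries fewer than \<open>p\<close> terms, mixed zero-sum blocks exist, because a block that
  leaves a given line is either mixed or lies on a second line, and in the latter case a block leaving that
  second line is mixed or can be added to it. Take \<open>U\<close> of greatest length among the mixed zero-sum blocks.
  If \<open>\<bar>U\<bar> \<le> k\<close>, the rest \<open>V\<close> of \<open>Q\<close> has at least \<open>2p - 2\<close> terms and contains no zero-sum block.
  For \<open>u\<close> in \<open>U\<close>, apply the exchange lemma to \<open>V\<close> together with \<open>u\<close>, the line through \<open>u\<close> and the
  prescribed subsequence \<open>u\<close>: since no block lies inside \<open>V\<close>, it expresses \<open>u\<close> as a sum of at
  least two terms of \<open>V\<close>. Replacing \<open>u\<close> by these lengthens \<open>U\<close> and keeps it mixed, a contradiction.
\<close>

section \<open>Affine forms on a cube of subsets\<close>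

text \<open>
  Affine forms on the cube of subsets of \<open>I\<close> are polynomials of degree one in the indicator
  variables, and the alternating sum extracts the coefficient of the top monomial, of degree
  \<open>card I\<close>. Summing only over the supersets of \<open>K\<close> is what makes an induction on the number of
  factors possible: multiplying a form out turns its term at \<open>i\<close> into the additional condition
  that \<open>i\<close> belongs to the subset.
\<close>
lemma alternating_sum_affine_product:
  fixes c0 :: "'j \<Rightarrow> 'a::comm_ring_1" and c :: "'j \<Rightarrow> 'i \<Rightarrow> 'a"
  assumes "finite I" and "finite J" and "K \<subseteq> I" and "card J + card K < card I"
  shows "(\<Sum>W | W \<subseteq> I \<and> K \<subseteq> W. (-1) ^ card W * (\<Prod>j\<in>J. c0 j + (\<Sum>i\<in>W. c j i))) = 0"
  using assms(2,3,4)
proof (induction J arbitrary: K rule: finite_induct)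
  case empty
  then have "K \<subset> I" by auto
  then show ?case
    using card_subsupersets_even_odd[OF assms(1), of K] assms(1)
    by (simp add: sum_alternating_cancels conj_ac)
next
  case (insert j J)
  let ?P = "\<lambda>W. (-1) ^ card W * (\<Prod>j\<in>J. c0 j + (\<Sum>i\<in>W. c j i))"
  have fin: "finite {W. W \<subseteq> I \<and> K \<subseteq> W}" using assms(1) by simp
  have finK: "finite K" using insert.prems(1) assms(1) finite_subset by blast
  have vanish: "(\<Sum>W | W \<subseteq> I \<and> Set.insert i K \<subseteq> W. ?P W) = 0" if "i \<in> I" for i
  proof (rule insert.IH)
    show "Set.insert i K \<subseteq> I" using that insert.prems(1) by simp
    show "card J + card (Set.insert i K) < card I"
      using insert.prems(2) insert.hyps finK
      by (simp add: card_insert_if split: if_splits)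
  qed
  have "(\<Sum>W | W \<subseteq> I \<and> K \<subseteq> W. (-1) ^ card W * (\<Prod>j\<in>Set.insert j J. c0 j + (\<Sum>i\<in>W. c j i)))
      = (\<Sum>W | W \<subseteq> I \<and> K \<subseteq> W. c0 j * ?P W + (\<Sum>i\<in>I. if i \<in> W then c j i * ?P W else 0))"
  proof (rule sum.cong[OF refl])
    fix W assume W: "W \<in> {W. W \<subseteq> I \<and> K \<subseteq> W}"
    then have "(\<Sum>i\<in>I. if i \<in> W then c j i * ?P W else 0) = (\<Sum>i\<in>W. c j i) * ?P W"
      using assms(1) by (simp add: sum.inter_restrict[symmetric] Int_absorb1 sum_distrib_right)
    then show "(-1) ^ card W * (\<Prod>j\<in>Set.insert j J. c0 j + (\<Sum>i\<in>W. c j i))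
        = c0 j * ?P W + (\<Sum>i\<in>I. if i \<in> W then c j i * ?P W else 0)"
      using insert.hyps by (simp add: algebra_simps)
  qed
  also have "\<dots> = c0 j * (\<Sum>W | W \<subseteq> I \<and> K \<subseteq> W. ?P W)
      + (\<Sum>i\<in>I. \<Sum>W | W \<subseteq> I \<and> K \<subseteq> W. if i \<in> W then c j i * ?P W else 0)"
    by (simp only: sum.distrib sum_distrib_left sum.swap[of _ I])
  also have "(\<Sum>i\<in>I. \<Sum>W | W \<subseteq> I \<and> K \<subseteq> W. if i \<in> W then c j i * ?P W else 0)
      = (\<Sum>i\<in>I. c j i * (\<Sum>W | W \<subseteq> I \<and> Set.insert i K \<subseteq> W. ?P W))"
  proof (rule sum.cong[OF refl])
    fix i
    have "(\<Sum>W | W \<subseteq> I \<and> K \<subseteq> W. if i \<in> W then c j i * ?P W else 0)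
        = (\<Sum>W \<in> {W. W \<subseteq> I \<and> K \<subseteq> W} \<inter> {W. i \<in> W}. c j i * ?P W)"
      using fin by (simp add: sum.inter_restrict)
    also have "{W. W \<subseteq> I \<and> K \<subseteq> W} \<inter> {W. i \<in> W} = {W. W \<subseteq> I \<and> Set.insert i K \<subseteq> W}"
      by auto
    finally show "(\<Sum>W | W \<subseteq> I \<and> K \<subseteq> W. if i \<in> W then c j i * ?P W else 0)
        = c j i * (\<Sum>W | W \<subseteq> I \<and> Set.insert i K \<subseteq> W. ?P W)"
      by (simp add: sum_distrib_left)
  qed
  also have "\<dots> = 0" using vanish by simp
  also have "(\<Sum>W | W \<subseteq> I \<and> K \<subseteq> W. ?P W) = 0"
    using insert.prems insert.hyps by (intro insert.IH) auto
  finally show ?case by simp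
qed

text \<open>
  A form is given as the pair of its constant term, which is its value at the empty subsequence,
  and its coefficient function. If the product of all forms vanished at every nonempty subsequence,
  its alternating sum would be its value at the empty one, which is not zero.
\<close>
lemma nonvanishing_subsequence:
  fixes F :: "('a::idom \<times> ('v \<Rightarrow> 'a)) set" and S :: "'v multiset"
  assumes "finite F" and "card F < size S" and "\<And>c0 c. (c0, c) \<in> F \<Longrightarrow> c0 \<noteq> 0"
  obtains W where "W \<subseteq># S" and "W \<noteq> {#}" and "\<And>c0 c. (c0, c) \<in> F \<Longrightarrow> c0 + (\<Sum>w\<in>#W. c w) \<noteq> 0"
proof -
  obtain xs where xs: "mset xs = S" using ex_mset by blast
  define I where "I = {..<length xs}"
  have I: "finite I" "card I = size S" "I \<noteq> {}" using xs assms(2) by (auto simp: I_def)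
  define M where "M W = image_mset ((!) xs) (mset_set W)" for W
  define P where "P W = (\<Prod>f\<in>F. fst f + (\<Sum>i\<in>W. snd f (xs ! i)))" for W
  have MI: "M I = S"
    unfolding M_def I_def using xs by (metis map_nth mset_map mset_upt atLeast0LessThan)
  have M_sum: "(\<Sum>w\<in>#M W. c w) = (\<Sum>i\<in>W. c (xs ! i))" for W and c :: "'v \<Rightarrow> 'a"
    by (simp add: M_def sum_unfold_sum_mset image_mset.compositionality o_def)
  have "\<exists>W. W \<subseteq> I \<and> W \<noteq> {} \<and> P W \<noteq> 0"
  proof (rule ccontr)
    assume "\<not> ?thesis"
    then have "(\<Sum>W | W \<subseteq> I \<and> {} \<subseteq> W. (-1) ^ card W * P W)
        = (\<Sum>W | W \<subseteq> I \<and> {} \<subseteq> W. if W = {} then P {} else 0)"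
      by (intro sum.cong) auto
    also have "\<dots> = P {}" using I by simp
    finally have "P {} = 0"
      using alternating_sum_affine_product[of I F "{}" fst "\<lambda>f i. snd f (xs ! i)"] I assms
      by (simp add: P_def)
    then show False using assms(1,3) by (auto simp: P_def)
  qed
  then obtain W where W: "W \<subseteq> I" "W \<noteq> {}" "P W \<noteq> 0" by blast
  have fW: "finite W" using W I finite_subset by blast
  show thesis
  proof (rule that)
    show "M W \<subseteq># S"
      unfolding MI[symmetric] M_def using W I
      by (intro image_mset_subseteq_mono subset_imp_msubset_mset_set)
    show "M W \<noteq> {#}" using W fW by (simp add: M_def mset_set_empty_iff)
    show "c0 + (\<Sum>w\<in>#M W. c w) \<noteq> 0" if "(c0, c) \<in> F" for c0 c
      using W(3) that assms(1) unfolding P_def M_sum by (force simp: prod_zero_iff)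
  qed
qed

section \<open>Growth of sumsets in the prime field\<close>

text \<open>
  A set closed under translation by \<open>d\<close> is a union of cosets of the subgroup generated by \<open>d\<close>, and
  that subgroup is everything.
\<close>
lemma translate_escapes:
  fixes X :: "'p::prime_card mod_ring set"
  assumes "X \<noteq> {}" and "X \<noteq> UNIV" and "d \<noteq> 0"
  shows "\<exists>x\<in>X. x + d \<notin> X"
proof (rule ccontr)
  assume "\<not> ?thesis"
  then have step: "x + d \<in> X" if "x \<in> X" for x using that by blast
  obtain x where x: "x \<in> X" using assms(1) by blast
  have "x + of_nat n * d \<in> X" for n
  proof (induction n)
    case (Suc n)
    then show ?case using step[of "x + of_nat n * d"] by (simp add: algebra_simps)
  qed (simp add: x)
  moreover have "\<exists>n. y = x + of_nat n * d" for y
    using surj_of_nat_mod_ring[of "(y - x) / d"] assms(3) by (force simp: field_simps)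
  ultimately have "X = UNIV" by (metis UNIV_eq_I)
  then show False using assms(2) by simp
qed

lemma card_two_translates:
  fixes X :: "'p::prime_card mod_ring set"
  assumes "X \<noteq> {}" and "a \<noteq> b"
  shows "min CARD('p) (card X + 1) \<le> card ((\<lambda>x. x + a) ` X \<union> (\<lambda>x. x + b) ` X)"
proof -
  have card_im: "card ((\<lambda>x. x + a) ` X) = card X" by (simp add: card_image)
  show ?thesis
  proof (cases "X = UNIV")
    case True
    then have "(\<lambda>x. x + a) ` X = UNIV" by (simp add: surj_plus_right)
    then show ?thesis by simp
  next
    case False
    then obtain x where x: "x \<in> X" "x + (b - a) \<notin> X"
      using translate_escapes[of X "b - a"] assms by auto
    have "x + b \<notin> (\<lambda>x. x + a) ` X"
    proof
      assume "x + b \<in> (\<lambda>x. x + a) ` X"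
      then obtain y where "y \<in> X" "x + b = y + a" by blast
      then have "x + (b - a) = y" by (simp add: algebra_simps)
      then show False using x \<open>y \<in> X\<close> by simp
    qed
    then have "card (insert (x + b) ((\<lambda>x. x + a) ` X)) = card X + 1"
      using card_im by simp
    moreover have "card (insert (x + b) ((\<lambda>x. x + a) ` X))
        \<le> card ((\<lambda>x. x + a) ` X \<union> (\<lambda>x. x + b) ` X)"
      using x by (intro card_mono) auto
    ultimately show ?thesis by simp
  qed
qed

lemma card_subset_sums:
  fixes f :: "'v \<Rightarrow> 'p::prime_card mod_ring"
  assumes "\<And>t. t \<in># T \<Longrightarrow> f t \<noteq> 0"
  shows "min CARD('p) (size T + 1) \<le> card ((\<lambda>R. \<Sum>r\<in>#R. f r) ` {R. R \<subseteq># T})"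
  using assms
proof (induction T)
  case (add t T)
  let ?X = "(\<lambda>R. \<Sum>r\<in>#R. f r) ` {R. R \<subseteq># T}"
  have "?X \<noteq> {}" by auto
  moreover have "f t \<noteq> 0" using add.prems by simp
  ultimately have "min CARD('p) (card ?X + 1) \<le> card ((\<lambda>x. x + 0) ` ?X \<union> (\<lambda>x. x + f t) ` ?X)"
    using card_two_translates by metis
  also have "\<dots> \<le> card ((\<lambda>R. \<Sum>r\<in>#R. f r) ` {R. R \<subseteq># add_mset t T})"
  proof (rule card_mono[OF finite])
    have "\<Sum>\<^sub># (image_mset f R) + f t \<in> (\<lambda>R. \<Sum>r\<in>#R. f r) ` {R. R \<subseteq># add_mset t T}" if "R \<subseteq># T" for R
      using that by (intro image_eqI[of _ _ "add_mset t R"]) (auto simp: add.commute)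
    moreover have "R \<subseteq># add_mset t T" if "R \<subseteq># T" for R
      by (rule subset_mset.order_trans[OF that]) simp
    ultimately show "(\<lambda>x. x + 0) ` ?X \<union> (\<lambda>x. x + f t) ` ?X
        \<subseteq> (\<lambda>R. \<Sum>r\<in>#R. f r) ` {R. R \<subseteq># add_mset t T}" by auto
  qed
  finally show ?case using add by force
qed simp

section \<open>The determinant form and lines\<close>

text \<open>
  Lines are handled through the determinant form: the line spanned by a nonzero vector \<open>l\<close> is the
  set of zeros of \<open>det2 l\<close>. This turns membership in a line into a linear equation, as the
  polynomial method needs, and \<open>det2\<close> is also the commutator that governs the order values.
\<close>
definition det2 :: "'a::field ^ 2 \<Rightarrow> 'a ^ 2 \<Rightarrow> 'a" where
  "det2 u v = u $ 1 * v $ 2 - u $ 2 * v $ 1"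

lemma det2_simps [simp]:
  "det2 u 0 = 0" "det2 0 u = 0" "det2 u u = 0"
  "det2 u (v + w) = det2 u v + det2 u w" "det2 (v + w) u = det2 v u + det2 w u"
  "det2 u (- v) = - det2 u v" "det2 (- v) u = - det2 v u"
  "det2 u (v - w) = det2 u v - det2 u w" "det2 (v - w) u = det2 v u - det2 w u"
  "det2 u (k *s v) = k * det2 u v" "det2 (k *s v) u = k * det2 v u"
  by (simp_all add: det2_def algebra_simps)

lemma det2_swap: "det2 u v = - det2 v u"
  by (simp add: det2_def algebra_simps)

lemma det2_sum_mset: "det2 u (\<Sum>\<^sub># M) = (\<Sum>v\<in>#M. det2 u v)"
  by (induction M) auto

lemma det2_sum_mset_eq_0: "(\<And>v. v \<in># M \<Longrightarrow> det2 u v = 0) \<Longrightarrow> det2 u (\<Sum>\<^sub># M) = 0"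
  by (induction M) auto

lemma nonzero_component: "(l :: 'a::zero ^ 2) \<noteq> 0 \<Longrightarrow> l $ 1 \<noteq> 0 \<or> l $ 2 \<noteq> 0"
  by (auto simp: vec_eq_iff forall_2)

lemma det2_eq_0_iff_multiple:
  assumes "l \<noteq> 0"
  shows "det2 l v = 0 \<longleftrightarrow> (\<exists>k. v = k *s l)"
proof
  assume *: "det2 l v = 0"
  show "\<exists>k. v = k *s l"
  proof (cases "l $ 1 = 0")
    case True
    then show ?thesis using * nonzero_component[OF assms]
      by (intro exI[of _ "v $ 2 / l $ 2"]) (auto simp: det2_def vec_eq_iff forall_2 field_simps)
  next
    case False
    then show ?thesis using *
      by (intro exI[of _ "v $ 1 / l $ 1"]) (auto simp: det2_def vec_eq_iff forall_2 field_simps)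
  qed
qed auto

lemma det2_trans: "l \<noteq> 0 \<Longrightarrow> det2 l u = 0 \<Longrightarrow> det2 l v = 0 \<Longrightarrow> det2 u v = 0"
  by (auto simp: det2_eq_0_iff_multiple)

lemma is_line_iff: "is_line L \<longleftrightarrow> (\<exists>l. l \<noteq> 0 \<and> L = {v. det2 l v = 0})"
proof
  assume L: "is_line L"
  then obtain B where B: "B \<subseteq> L" "vec.independent B" "L \<subseteq> vec.span B" "card B = 1"
    using vec.basis_exists[of L] by (auto simp: is_line_def)
  then obtain l where l: "B = {l}" using card_1_singletonE by blast
  have "l \<noteq> 0" using B l vec.dependent_zero by blast
  moreover have "L = vec.span {l}"
    using B l L vec.span_minimal by (metis is_line_def subset_antisym)
  ultimately show "\<exists>l. l \<noteq> 0 \<and> L = {v. det2 l v = 0}"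
    by (intro exI[of _ l]) (auto simp: vec.span_singleton det2_eq_0_iff_multiple)
next
  assume "\<exists>l. l \<noteq> 0 \<and> L = {v. det2 l v = 0}"
  then obtain l where l: "l \<noteq> 0" "L = {v. det2 l v = 0}" by blast
  then have "L = vec.span {l}" by (auto simp: vec.span_singleton det2_eq_0_iff_multiple)
  then show "is_line L" using l(1) by (simp add: is_line_def)
qed

text \<open>
  Among nonzero vectors this is the same as being mixed; the form with two witnesses passes
  directly to larger sequences.
\<close>
definition noncollinear :: "('a::field ^ 2) multiset \<Rightarrow> bool" where
  "noncollinear U \<longleftrightarrow> (\<exists>x\<in>#U. \<exists>y\<in>#U. det2 x y \<noteq> 0)"

lemma noncollinearI: "x \<in># U \<Longrightarrow> y \<in># U \<Longrightarrow> det2 x y \<noteq> 0 \<Longrightarrow> noncollinear U"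
  by (auto simp: noncollinear_def)

lemma mixed_seq_iff:
  assumes "0 \<notin># U"
  shows "mixed_seq U \<longleftrightarrow> noncollinear U"
  unfolding noncollinear_def
proof
  assume mixed: "mixed_seq U"
  show "\<exists>x\<in>#U. \<exists>y\<in>#U. det2 x y \<noteq> 0"
  proof (cases "U = {#}")
    case True
    \<comment> \<open>The empty sequence is collinear because the plane contains some line.\<close>
    have "is_line {v. det2 (axis 1 1 :: 'a^2) v = 0}"
      unfolding is_line_iff by (intro exI[of _ "axis 1 1"]) (auto simp: axis_eq_0_iff)
    then show ?thesis using mixed True by (auto simp: mixed_seq_def collinear_seq_def)
  next
    case False
    then obtain x where x: "x \<in># U" by blast
    then have "is_line {v. det2 x v = 0}" using assms is_line_iff by metis
    then show ?thesis using mixed x by (auto simp: mixed_seq_def collinear_seq_def)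
  qed
next
  assume "\<exists>x\<in>#U. \<exists>y\<in>#U. det2 x y \<noteq> 0"
  then show "mixed_seq U"
    unfolding mixed_seq_def collinear_seq_def is_line_iff using det2_trans by blast
qed

text \<open>
  A coordinate on the line through \<open>l\<close>: one of the two standard coordinates is not zero at \<open>l\<close>
  and is therefore injective on the line.
\<close>
lemma line_coordinate:
  fixes l :: "'a::field ^ 2"
  assumes "l \<noteq> 0"
  obtains f :: "'a ^ 2 \<Rightarrow> 'a" where "\<And>M. f (\<Sum>\<^sub># M) = (\<Sum>v\<in>#M. f v)"
    and "\<And>u v. f (u - v) = f u - f v" and "\<And>v. det2 l v = 0 \<Longrightarrow> f v = 0 \<Longrightarrow> v = 0"
proof -
  have sum: "g (\<Sum>\<^sub># M) = (\<Sum>v\<in>#M. g v)"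
    if "\<And>u v. g (u + v) = g u + g v" "g 0 = 0" for g :: "'a ^ 2 \<Rightarrow> 'a" and M
    using that by (induction M) auto
  from nonzero_component[OF assms] show thesis
  proof
    assume "l $ 1 \<noteq> 0"
    then show thesis
      by (intro that[of "\<lambda>v. v $ 1"] sum) (auto simp: det2_def vec_eq_iff forall_2)
  next
    assume "l $ 2 \<noteq> 0"
    then show thesis
      by (intro that[of "\<lambda>v. v $ 2"] sum) (auto simp: det2_def vec_eq_iff forall_2)
  qed
qed

lemma noncollinear_mono: "noncollinear U \<Longrightarrow> U \<subseteq># U' \<Longrightarrow> noncollinear U'"
  unfolding noncollinear_def by (meson mset_subset_eqD)

lemma det2_off_line: "t \<noteq> 0 \<Longrightarrow> det2 l t = 0 \<Longrightarrow> det2 l w \<noteq> 0 \<Longrightarrow> det2 t w \<noteq> 0"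
  using det2_trans[of t l w] det2_swap[of l t] by auto

text \<open>
  In a zero-sum sequence every term is minus the sum of the others, so it lies on any line that
  contains all the others.
\<close>
lemma noncollinear_remove:
  assumes "noncollinear U" and "\<Sum>\<^sub># U = 0" and "x \<in># U"
  shows "noncollinear (U - {#x#})"
proof (rule ccontr)
  assume collinear: "\<not> noncollinear (U - {#x#})"
  define M where "M = U - {#x#}"
  have U: "U = add_mset x M" using assms(3) by (simp add: M_def)
  have M: "det2 v w = 0" if "v \<in># M" "w \<in># M" for v w
    using that collinear by (auto simp: noncollinear_def M_def)
  have "x = - \<Sum>\<^sub># M"
    using assms(2) U by (simp add: eq_neg_iff_add_eq_0)
  then have x: "det2 v x = 0" if "v \<in># M" for v
    using det2_sum_mset_eq_0[of M v] M[OF that] by simp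
  then have "det2 x v = 0" if "v \<in># M" for v
    using that det2_swap[of x v] by simp
  then have "det2 v w = 0" if "v \<in># U" "w \<in># U" for v w
    using that M x U by auto
  then show False using assms(1) by (auto simp: noncollinear_def)
qed

section \<open>Growth of the set of order values\<close>

lemma sum_mset_component: "(\<Sum>\<^sub># M) $ i = (\<Sum>v\<in>#M. v $ i)"
  by (induction M) auto

lemma sum_nth_eq_sum_mset: "(\<Sum>i<length I. g (I ! i)) = (\<Sum>v\<in>#mset I. g v)"
  by (simp add: sum_list_sum_nth atLeast0LessThan sum_mset_sum_list flip: mset_map)

lemma q_ord_snoc: "q_ord (I @ [w]) = q_ord I + (\<Sum>\<^sub># (mset I)) $ 1 * w $ 2"
proof -
  have "(\<Sum>j<length I. \<Sum>i<j. (I @ [w]) ! i $ 1 * (I @ [w]) ! j $ 2) = q_ord I"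
    unfolding q_ord_def by (intro sum.cong) (auto simp: nth_append)
  moreover have "(\<Sum>i<length I. (I @ [w]) ! i $ 1 * w $ 2) = (\<Sum>\<^sub># (mset I)) $ 1 * w $ 2"
    by (simp add: nth_append sum_distrib_right[symmetric] sum_mset_component
        sum_nth_eq_sum_mset[of "\<lambda>v. v $ 1"])
  ultimately show ?thesis by (simp add: q_ord_def)
qed

lemma q_ord_Cons: "q_ord (w # I) = q_ord I + w $ 1 * (\<Sum>\<^sub># (mset I)) $ 2"
  by (simp add: q_ord_def sum.lessThan_Suc_shift sum.distrib sum_distrib_left[symmetric]
      sum_mset_component sum_nth_eq_sum_mset[of "\<lambda>v. v $ 2"] del: sum.lessThan_Suc)

lemma Omega_add_mset:
  "(\<lambda>x. x + (\<Sum>\<^sub># P) $ 1 * w $ 2) ` Omega P \<union> (\<lambda>x. x + w $ 1 * (\<Sum>\<^sub># P) $ 2) ` Omega P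
    \<subseteq> Omega (add_mset w P)"
proof -
  have "q_ord I + (\<Sum>\<^sub># P) $ 1 * w $ 2 \<in> Omega (add_mset w P)"
    "q_ord I + w $ 1 * (\<Sum>\<^sub># P) $ 2 \<in> Omega (add_mset w P)" if "mset I = P" for I
    using that q_ord_snoc[of I w] q_ord_Cons[of w I]
    by (auto simp: Omega_def permutations_of_multiset_def intro: image_eqI[of _ _ "I @ [w]"]
        image_eqI[of _ _ "w # I"])
  then show ?thesis by (auto simp: Omega_def permutations_of_multiset_def)
qed

lemma Omega_nonempty: "Omega P \<noteq> {}"
  using permutations_of_multiset_not_empty by (auto simp: Omega_def)

lemma card_Omega_mono:
  fixes w :: "'a::{field,finite} ^ 2"
  shows "card (Omega P) \<le> card (Omega (add_mset w P))"
proof -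
  have "card (Omega P) = card ((\<lambda>x. x + (\<Sum>\<^sub># P) $ 1 * w $ 2) ` Omega P)"
    by (simp add: card_image)
  also have "\<dots> \<le> card (Omega (add_mset w P))"
    using Omega_add_mset by (intro card_mono) auto
  finally show ?thesis .
qed

text \<open>
  The two translates in \<open>Omega_add_mset\<close> come from placing \<open>w\<close> last and first; their translation
  vectors differ by \<open>det2 (\<Sum>\<^sub># P) w\<close>.
\<close>
lemma card_Omega_step:
  fixes w :: "'p::prime_card mod_ring ^ 2"
  assumes "det2 (\<Sum>\<^sub># P) w \<noteq> 0"
  shows "min CARD('p) (card (Omega P) + 1) \<le> card (Omega (add_mset w P))"
proof -
  have "(\<Sum>\<^sub># P) $ 1 * w $ 2 \<noteq> w $ 1 * (\<Sum>\<^sub># P) $ 2"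
    using assms by (auto simp: det2_def algebra_simps)
  then show ?thesis
    using order_trans[OF card_two_translates[OF Omega_nonempty] card_mono[OF finite Omega_add_mset]]
    by blast
qed

text \<open>
  The greedy step for ordering a block. Here \<open>R\<close> is what is still to be placed, so its sum is minus
  the current partial sum, and the next term has to avoid the line through it without leaving a
  collinear rest. A term \<open>x\<close> off the line through the sum serves unless the rest \<open>M\<close> after \<open>x\<close> lies
  on one line. In that case \<open>x\<close> is not on the line of \<open>M\<close>, so neither is the sum of \<open>R\<close>, and any
  term of \<open>M\<close> can be used: another one stays behind together with \<open>x\<close>.
\<close>
lemma exists_transverse_term:
  assumes "noncollinear R" and "0 \<notin># R" and "\<Sum>\<^sub># R \<noteq> 0" and "3 \<le> size R"
  obtains e where "e \<in># R" and "det2 (\<Sum>\<^sub># R) e \<noteq> 0" and "noncollinear (R - {#e#})"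
proof -
  obtain x where x: "x \<in># R" "det2 (\<Sum>\<^sub># R) x \<noteq> 0"
    using assms(1) det2_trans[OF assms(3)] unfolding noncollinear_def by blast
  define M where "M = R - {#x#}"
  have R: "R = add_mset x M" using x by (simp add: M_def)
  show thesis
  proof (cases "noncollinear M")
    case True
    then show thesis using that x M_def by blast
  next
    case False
    then have M: "det2 v w = 0" if "v \<in># M" "w \<in># M" for v w
      using that by (auto simp: noncollinear_def)
    have off: "det2 x v \<noteq> 0" if v: "v \<in># M" for v
    proof
      assume "det2 x v = 0"
      then have "det2 v w = 0" if "w \<in># R" for w
        using that M[OF v] det2_swap[of v x] R by auto
      moreover have "v \<noteq> 0" using v assms(2) R by auto
      ultimately show False using assms(1) det2_trans unfolding noncollinear_def by blast
    qed
    obtain y N where y: "M = add_mset y N" using assms(4) R by (cases M) auto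
    obtain z where z: "z \<in># N" using assms(4) R y by (cases N) auto
    have "det2 y (\<Sum>\<^sub># M) = 0"
      using M[of y] y by (intro det2_sum_mset_eq_0) auto
    then have "det2 (\<Sum>\<^sub># R) y = det2 x y"
      using R det2_swap[of "\<Sum>\<^sub># M" y] by simp
    moreover have "noncollinear (R - {#y#})"
      using off[of z] z y R by (intro noncollinearI[of x _ z]) auto
    ultimately show thesis using that[of y] off[of y] y R by auto
  qed
qed

text \<open>
  Every term of \<open>R\<close> except the last one placed gives a gain of one. The sum stays nonzero along the
  way, because a term transverse to it is transverse to the new sum as well.
\<close>
lemma card_Omega_extend:
  fixes P R :: "('p::prime_card mod_ring ^ 2) multiset"
  assumes "noncollinear R" and "0 \<notin># R" and "\<Sum>\<^sub># R \<noteq> 0" and "\<Sum>\<^sub># P = - \<Sum>\<^sub># R"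
  shows "min CARD('p) (card (Omega P) + size R - 1) \<le> card (Omega (P + R))"
  using assms
proof (induction "size R" arbitrary: P R rule: less_induct)
  case less
  obtain x y where xy: "x \<in># R" "y \<in># R" "det2 x y \<noteq> 0"
    using less.prems(1) by (auto simp: noncollinear_def)
  then have "x \<noteq> y" by auto
  obtain R1 where R1: "R = add_mset x R1" using multi_member_split[OF xy(1)] by blast
  then have "y \<in># R1" using xy(2) \<open>x \<noteq> y\<close> by simp
  then obtain N where R: "R = add_mset x (add_mset y N)"
    using multi_member_split[of y R1] R1 by blast
  show ?case
  proof (cases "N = {#}")
    case True
    \<comment> \<open>Two independent terms remain: the first is transverse to their sum, the second completes
      the block and is parallel to the partial sum before it.\<close>
    have "det2 (\<Sum>\<^sub># P) x \<noteq> 0"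
      using xy(3) less.prems(4) R True det2_swap[of x y] by simp
    then have "min CARD('p) (card (Omega P) + 1) \<le> card (Omega (add_mset x P))"
      by (rule card_Omega_step)
    also have "\<dots> \<le> card (Omega (add_mset y (add_mset x P)))" by (rule card_Omega_mono)
    finally show ?thesis using R True by (simp add: add_mset_commute)
  next
    case False
    then have "3 \<le> size R" using R by (cases N) auto
    then obtain e where e: "e \<in># R" "det2 (\<Sum>\<^sub># R) e \<noteq> 0" "noncollinear (R - {#e#})"
      using exists_transverse_term less.prems(1-3) by blast
    define R' where "R' = R - {#e#}"
    have R': "R = add_mset e R'" using e by (simp add: R'_def)
    have PR: "P + R = add_mset e P + R'" using R' by simp
    have "min CARD('p) (card (Omega (add_mset e P)) + size R' - 1) \<le> card (Omega (P + R))"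
      unfolding PR
    proof (rule less.hyps)
      show "size R' < size R" "0 \<notin># R'" using R' less.prems(2) by auto
      show "noncollinear R'" using e(3) by (simp add: R'_def)
      have "det2 (\<Sum>\<^sub># R') e \<noteq> 0" using e(2) R' by simp
      then show "\<Sum>\<^sub># R' \<noteq> 0" by auto
      show "\<Sum>\<^sub># (add_mset e P) = - \<Sum>\<^sub># R'" using less.prems(4) R' by simp
    qed
    moreover have "min CARD('p) (card (Omega P) + 1) \<le> card (Omega (add_mset e P))"
      using e(2) less.prems(4) by (intro card_Omega_step) simp
    moreover have "size R = size R' + 1" "1 \<le> size R'" using R' \<open>3 \<le> size R\<close> by simp_all
    ultimately show ?thesis by linarith
  qed
qed

lemma card_Omega_zero_sum:
  fixes U :: "('p::prime_card mod_ring ^ 2) multiset"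
  assumes "noncollinear U" and "0 \<notin># U" and "\<Sum>\<^sub># U = 0"
  shows "min CARD('p) (size U - 1) \<le> card (Omega U)"
proof -
  obtain x where x: "x \<in># U" using assms(1) by (auto simp: noncollinear_def)
  define R where "R = U - {#x#}"
  have U: "U = {#x#} + R" using x by (simp add: R_def)
  have R: "\<Sum>\<^sub># R = - x" using assms(3) U by (simp add: eq_neg_iff_add_eq_0 add.commute)
  have "min CARD('p) (card (Omega {#x#}) + size R - 1) \<le> card (Omega ({#x#} + R))"
  proof (rule card_Omega_extend)
    show "noncollinear R" using noncollinear_remove[OF assms(1,3) x] by (simp add: R_def)
    show "0 \<notin># R" using assms(2) U by auto
    show "\<Sum>\<^sub># R \<noteq> 0" using R x assms(2) by auto
    show "\<Sum>\<^sub># {#x#} = - \<Sum>\<^sub># R" using R by simp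
  qed
  then have "min CARD('p) (card (Omega {#x#}) + size R - 1) \<le> card (Omega U)"
    by (simp only: U[symmetric])
  moreover have "card (Omega {#x#}) \<ge> 1"
    using Omega_nonempty by (simp add: Suc_le_eq card_gt_0_iff)
  moreover have "size U - 1 = size R" using U by simp
  ultimately show ?thesis by linarith
qed

section \<open>Completing terms off a line to a zero-sum block\<close>

text \<open>
  The exchange lemma. The trivial solution is \<open>W = {#}\<close> and \<open>T' = T0\<close>, and the point is that there
  is another one. Apply \<open>nonvanishing_subsequence\<close> to \<open>S\<close> with three families of forms, \<open>f\<close> being a
  coordinate on the line: \<open>det2 l\<close> plus each nonzero constant (\<open>p - 1\<close> forms) forces the sum of \<open>W\<close>
  onto the line; \<open>f\<close> plus each constant outside the set \<open>X\<close> of differences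
  \<open>f (\<Sum>\<^sub># T') - f (\<Sum>\<^sub># T0)\<close> (at most \<open>p - size T - 1\<close> forms, by the bound on subset sums) forces
  this sum to be compensated within \<open>T\<close>; and the length minus \<open>j\<close>, for \<open>2 \<le> j \<le> e + 1\<close>, forces
  \<open>W\<close> to be long. The length one needs no form since a single term of \<open>S\<close> is off the line. None of
  the forms vanishes at the empty subsequence: for the second family because \<open>0 \<in> X\<close>, for the third
  because \<open>e + 1 < p\<close>.
\<close>
lemma compensated_subsequence:
  fixes S T :: "('p::prime_card mod_ring ^ 2) multiset"
  assumes l: "l \<noteq> 0"
    and S: "\<And>v. v \<in># S \<Longrightarrow> det2 l v \<noteq> 0"
    and T: "\<And>v. v \<in># T \<Longrightarrow> det2 l v = 0" "0 \<notin># T" "size T < CARD('p)"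
    and T0: "T0 \<subseteq># T"
    and size: "2 * CARD('p) - 1 + e \<le> size S + size T" and e: "e + 2 \<le> CARD('p)"
  shows "\<exists>W T'. W \<subseteq># S \<and> T' \<subseteq># T \<and> e + 2 \<le> size W
    \<and> \<Sum>\<^sub># W + \<Sum>\<^sub># T' = \<Sum>\<^sub># T0"
proof -
  let ?p = "CARD('p)"
  obtain f :: "'p mod_ring ^ 2 \<Rightarrow> 'p mod_ring" where f_sum: "\<And>M. f (\<Sum>\<^sub># M) = (\<Sum>v\<in>#M. f v)"
    and f_diff: "\<And>u v. f (u - v) = f u - f v" and f_inj: "\<And>v. det2 l v = 0 \<Longrightarrow> f v = 0 \<Longrightarrow> v = 0"
    using line_coordinate[OF l] by blast
  define X where "X = (\<lambda>R. (\<Sum>r\<in>#R. f r) - f (\<Sum>\<^sub># T0)) ` {R. R \<subseteq># T}"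
  have "X = (\<lambda>x. x - f (\<Sum>\<^sub># T0)) ` (\<lambda>R. \<Sum>r\<in>#R. f r) ` {R. R \<subseteq># T}"
    by (auto simp: X_def)
  then have "card X = card ((\<lambda>R. \<Sum>r\<in>#R. f r) ` {R. R \<subseteq># T})"
    by (simp add: card_image)
  moreover have "f t \<noteq> 0" if "t \<in># T" for t using f_inj T that by metis
  ultimately have card_X: "size T + 1 \<le> card X"
    using card_subset_sums[of T f] T(3) by simp
  have X0: "0 \<in> X" using T0 by (auto simp: X_def f_sum)
  define F :: "('p mod_ring \<times> ('p mod_ring ^ 2 \<Rightarrow> 'p mod_ring)) set" where
    "F = (\<lambda>c. (c, det2 l)) ` (UNIV - {0}) \<union> (\<lambda>c. (c, f)) ` (UNIV - X)
      \<union> (\<lambda>j. (- of_nat j, \<lambda>_. 1)) ` {2..e + 1}"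
  have "card F \<le> (?p - 1) + (?p - card X) + e"
  proof -
    have "card ((\<lambda>c. (c, det2 l)) ` (UNIV - {0 :: 'p mod_ring})) \<le> ?p - 1"
      by (rule order_trans[OF card_image_le]) auto
    moreover have "card ((\<lambda>c. (c, f)) ` (UNIV - X)) \<le> ?p - card X"
      by (rule order_trans[OF card_image_le]) (auto simp: card_Diff_subset)
    moreover have "card ((\<lambda>j. (- of_nat j :: 'p mod_ring, \<lambda>_::'p mod_ring ^ 2. 1 :: 'p mod_ring)) ` {2..e + 1}) \<le> e"
      by (rule order_trans[OF card_image_le]) auto
    ultimately show ?thesis
      unfolding F_def by (intro order_trans[OF card_Un_le] add_mono) auto
  qed
  moreover have "card X \<le> ?p" using card_mono[of UNIV X] by simp
  ultimately have "card F < size S" using card_X size e by linarith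
  moreover have "finite F" by (simp add: F_def)
  moreover have "c0 \<noteq> 0" if "(c0, c) \<in> F" for c0 c
  proof -
    have "of_nat j \<noteq> (0 :: 'p mod_ring)" if "2 \<le> j" "j \<le> e + 1" for j
      using that e by (auto dest!: of_nat_0_mod_ring_dvd dvd_imp_le)
    then show ?thesis using that X0 by (auto simp: F_def)
  qed
  ultimately obtain W where W: "W \<subseteq># S" "W \<noteq> {#}"
    and nz: "\<And>c0 c. (c0, c) \<in> F \<Longrightarrow> c0 + (\<Sum>w\<in>#W. c w) \<noteq> 0"
    using nonvanishing_subsequence[of F S] by metis
  have on_line: "det2 l (\<Sum>\<^sub># W) = 0"
  proof (rule ccontr)
    assume "det2 l (\<Sum>\<^sub># W) \<noteq> 0"
    then have "(- det2 l (\<Sum>\<^sub># W), det2 l) \<in> F" by (auto simp: F_def)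
    from nz[OF this] show False by (simp add: det2_sum_mset)
  qed
  have "- f (\<Sum>\<^sub># W) \<in> X"
  proof (rule ccontr)
    assume "- f (\<Sum>\<^sub># W) \<notin> X"
    then have "(- f (\<Sum>\<^sub># W), f) \<in> F" by (auto simp: F_def)
    from nz[OF this] show False by (simp add: f_sum)
  qed
  then obtain T' where T': "T' \<subseteq># T" "- f (\<Sum>\<^sub># W) = f (\<Sum>\<^sub># T') - f (\<Sum>\<^sub># T0)"
    by (auto simp: X_def f_sum)
  have sub: "det2 l (\<Sum>\<^sub># R) = 0" if "R \<subseteq># T" for R
    using T(1) mset_subset_eqD[OF that] by (intro det2_sum_mset_eq_0) auto
  have "\<Sum>\<^sub># T0 - \<Sum>\<^sub># T' - \<Sum>\<^sub># W = 0"
  proof (rule f_inj)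
    show "det2 l (\<Sum>\<^sub># T0 - \<Sum>\<^sub># T' - \<Sum>\<^sub># W) = 0" using T' T0 sub on_line by simp
    have "f (\<Sum>\<^sub># W) = f (\<Sum>\<^sub># T0) - f (\<Sum>\<^sub># T')" using arg_cong[OF T'(2), of uminus] by simp
    then show "f (\<Sum>\<^sub># T0 - \<Sum>\<^sub># T' - \<Sum>\<^sub># W) = 0" by (simp add: f_diff)
  qed
  then have "\<Sum>\<^sub># W + \<Sum>\<^sub># T' = \<Sum>\<^sub># T0" by (simp add: algebra_simps)
  moreover have "e + 2 \<le> size W"
  proof (rule ccontr)
    assume *: "\<not> e + 2 \<le> size W"
    have "size W \<noteq> 1"
    proof
      assume "size W = 1"
      then obtain w where "W = {#w#}" using size_1_singleton_mset by blast
      then show False using on_line S W(1) by auto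
    qed
    moreover have "size W \<noteq> 0" using W(2) by simp
    ultimately have "size W \<in> {2..e + 1}" using * unfolding atLeastAtMost_iff by linarith
    then have "(- of_nat (size W), \<lambda>_. 1) \<in> F" by (auto simp: F_def)
    from nz[OF this] show False by simp
  qed
  ultimately show ?thesis using W(1) T'(1) by blast
qed

section \<open>Long noncollinear zero-sum blocks\<close>

lemma submultiset_of_size:
  assumes "n \<le> size M"
  obtains N where "N \<subseteq># M" and "size N = n"
proof -
  obtain xs where xs: "mset xs = M" using ex_mset by blast
  have "M = mset (take n xs) + mset (drop n xs)"
    by (simp add: xs flip: mset_append)
  moreover have "size (mset (take n xs)) = n" using assms xs by auto
  ultimately show thesis using that by (metis mset_subset_eq_add_left)
qed

lemma subset_sums_fill_line:
  fixes T :: "('p::prime_card mod_ring ^ 2) multiset"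
  assumes l: "l \<noteq> 0" and T: "\<And>v. v \<in># T \<Longrightarrow> det2 l v = 0" "0 \<notin># T"
    and size: "CARD('p) - 1 \<le> size T" and g: "det2 l g = 0"
  obtains T0 where "T0 \<subseteq># T" and "\<Sum>\<^sub># T0 = g"
proof -
  obtain f :: "'p mod_ring ^ 2 \<Rightarrow> 'p mod_ring" where f_sum: "\<And>M. f (\<Sum>\<^sub># M) = (\<Sum>v\<in>#M. f v)"
    and f_diff: "\<And>u v. f (u - v) = f u - f v" and f_inj: "\<And>v. det2 l v = 0 \<Longrightarrow> f v = 0 \<Longrightarrow> v = 0"
    using line_coordinate[OF l] by blast
  have "f t \<noteq> 0" if "t \<in># T" for t using f_inj T that by metis
  then have "min CARD('p) (size T + 1) \<le> card ((\<lambda>R. \<Sum>r\<in>#R. f r) ` {R. R \<subseteq># T})"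
    by (rule card_subset_sums)
  then have "card (UNIV :: 'p mod_ring set) \<le> card ((\<lambda>R. \<Sum>r\<in>#R. f r) ` {R. R \<subseteq># T})"
    using size by simp
  then have "(\<lambda>R. \<Sum>r\<in>#R. f r) ` {R. R \<subseteq># T} = UNIV"
    by (intro card_seteq) auto
  then obtain T0 where T0: "T0 \<subseteq># T" "(\<Sum>r\<in>#T0. f r) = f g"
    by (metis (no_types, lifting) UNIV_I imageE mem_Collect_eq)
  have "det2 l (\<Sum>\<^sub># T0) = 0"
    using T(1) mset_subset_eqD[OF T0(1)] by (intro det2_sum_mset_eq_0) auto
  then have "\<Sum>\<^sub># T0 - g = 0"
    using g T0(2) by (intro f_inj) (auto simp: f_diff f_sum)
  then show thesis using that T0(1) by simp
qed

text \<open>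
  Split the terms on the line into \<open>T1\<close>, of size \<open>p - 1\<close>, and \<open>R\<close>. All of \<open>R\<close> is used; some
  subsequence \<open>T0\<close> of \<open>T1\<close> has sum \<open>- \<Sum>\<^sub># R\<close>, and the exchange lemma replaces \<open>T0\<close> by terms \<open>W\<close>
  off the line together with some \<open>T'\<close>. Its length parameter \<open>e\<close> is chosen to use up the number of
  terms off the line, and \<open>size W + size R\<close> is then at least \<open>k + 1\<close>.
\<close>
lemma long_block_if_heavy_line:
  fixes Q :: "('p::prime_card mod_ring ^ 2) multiset"
  assumes Q: "0 \<notin># Q" "size Q = 2 * CARD('p) + k - 2" and k: "k \<le> CARD('p)" and l: "l \<noteq> 0"
    and lower: "CARD('p) \<le> size {#v \<in># Q. det2 l v = 0#}"
    and upper: "size {#v \<in># Q. det2 l v = 0#} \<le> CARD('p) + k - 2"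
  obtains U where "U \<subseteq># Q" and "\<Sum>\<^sub># U = 0" and "noncollinear U" and "k + 1 \<le> size U"
proof -
  let ?p = "CARD('p)"
  define T where "T = {#v \<in># Q. det2 l v = 0#}"
  define S where "S = {#v \<in># Q. det2 l v \<noteq> 0#}"
  have QTS: "Q = T + S" unfolding T_def S_def by (rule multiset_partition)
  have p2: "2 \<le> ?p" using prime_card[where 'a = 'p] by (rule prime_ge_2_nat)
  have T: "det2 l v = 0" "v \<noteq> 0" if "v \<in># T" for v using that Q(1) by (auto simp: T_def)
  have "?p - 1 \<le> size T" using lower unfolding T_def by linarith
  then obtain T1 where T1: "T1 \<subseteq># T" "size T1 = ?p - 1"
    using submultiset_of_size by blast
  define R where "R = T - T1"
  have TR: "T = T1 + R" using T1(1) by (simp add: R_def)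
  have T1_line: "det2 l v = 0" if "v \<in># T1" for v using T TR that by auto
  have T1_0: "0 \<notin># T1" using T TR by auto
  have "det2 l (\<Sum>\<^sub># R) = 0" using T TR by (intro det2_sum_mset_eq_0) auto
  then obtain T0 where T0: "T0 \<subseteq># T1" "\<Sum>\<^sub># T0 = - \<Sum>\<^sub># R"
    using subset_sums_fill_line[OF l T1_line T1_0, of "- \<Sum>\<^sub># R"] T1(2) by auto
  define e where "e = ?p + k - 2 - size T"
  have sizes: "size T + size S = 2 * ?p + k - 2" "?p \<le> size T" "size T \<le> ?p + k - 2"
    using Q(2) arg_cong[OF QTS, of size] lower upper unfolding T_def[symmetric] by simp_all
  have S: "det2 l v \<noteq> 0" if "v \<in># S" for v using that by (simp add: S_def)
  have e: "size T + e + 2 = ?p + k" using sizes k p2 by (simp add: e_def)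
  have "\<exists>W T'. W \<subseteq># S \<and> T' \<subseteq># T1 \<and> e + 2 \<le> size W \<and> \<Sum>\<^sub># W + \<Sum>\<^sub># T' = \<Sum>\<^sub># T0"
  proof (rule compensated_subsequence[OF l S T1_line T1_0 _ T0(1)])
    show "size T1 < ?p" using T1(2) p2 by linarith
    show "2 * ?p - 1 + e \<le> size S + size T1" using T1(2) sizes(1) e p2 by linarith
    show "e + 2 \<le> ?p" using e sizes(2) k by linarith
  qed
  then obtain W T' where W: "W \<subseteq># S" "T' \<subseteq># T1" "e + 2 \<le> size W"
      "\<Sum>\<^sub># W + \<Sum>\<^sub># T' = \<Sum>\<^sub># T0" by blast
  show thesis
  proof (rule that)
    have "T' + W + R \<subseteq># T1 + S + R" using subset_mset.add_mono[OF W(2,1)] by simp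
    moreover have "W + T' + R = T' + W + R" "Q = T1 + S + R" by (simp_all add: QTS TR add_ac)
    ultimately show "W + T' + R \<subseteq># Q" by (simp only:)
    show "\<Sum>\<^sub># (W + T' + R) = 0" using W(4) T0(2) by simp
    have "R \<noteq> {#}" using TR T1(2) sizes(2) p2 by auto
    moreover have "W \<noteq> {#}" using W(3) by auto
    ultimately obtain t w where "t \<in># R" "w \<in># W" by blast
    moreover from this have "det2 t w \<noteq> 0"
      using T[of t] TR S[of w] mset_subset_eqD[OF W(1)] by (intro det2_off_line[of t l]) auto
    ultimately show "noncollinear (W + T' + R)" by (intro noncollinearI[of t _ w]) auto
    have "size T = ?p - 1 + size R" using TR T1(2) by simp
    then show "k + 1 \<le> size (W + T' + R)" using W(3) e p2 by simp
  qed
qed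

lemma block_leaving_line:
  fixes Q :: "('p::prime_card mod_ring ^ 2) multiset"
  assumes Q: "0 \<notin># Q" "2 * CARD('p) - 1 \<le> size Q" and l: "l \<noteq> 0"
    and light: "size {#v \<in># Q. det2 l v = 0#} < CARD('p)"
  obtains U w where "U \<subseteq># Q" and "\<Sum>\<^sub># U = 0" and "w \<in># U" and "det2 l w \<noteq> 0"
proof -
  define T where "T = {#v \<in># Q. det2 l v = 0#}"
  define S where "S = {#v \<in># Q. det2 l v \<noteq> 0#}"
  have QTS: "Q = T + S" unfolding T_def S_def by (rule multiset_partition)
  have "\<exists>W T'. W \<subseteq># S \<and> T' \<subseteq># T \<and> 0 + 2 \<le> size W \<and> \<Sum>\<^sub># W + \<Sum>\<^sub># T' = \<Sum>\<^sub># {#}"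
  proof (rule compensated_subsequence[OF l])
    show "size T < CARD('p)" using light by (simp add: T_def)
    show "2 * CARD('p) - 1 + 0 \<le> size S + size T" using Q(2) QTS by simp
    show "0 + 2 \<le> CARD('p)" using prime_ge_2_nat[OF prime_card[where 'a = 'p]] by simp
  qed (use Q(1) in \<open>auto simp: S_def T_def\<close>)
  then obtain W T' where W: "W \<subseteq># S" "T' \<subseteq># T" "2 \<le> size W" "\<Sum>\<^sub># W + \<Sum>\<^sub># T' = 0"
    by auto
  have "W \<noteq> {#}" using W(3) by auto
  then obtain w where w: "w \<in># W" by blast
  show thesis
  proof (rule that)
    show "W + T' \<subseteq># Q"
      unfolding QTS using subset_mset.add_mono[OF W(2,1)] by (simp add: add.commute)
    show "\<Sum>\<^sub># (W + T') = 0" using W by simp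
    show "w \<in># W + T'" using w by simp
    show "det2 l w \<noteq> 0" using mset_subset_eqD[OF W(1) w] by (simp add: S_def)
  qed
qed

text \<open>
  If no block were noncollinear, a block \<open>U1\<close> would lie on the line of one of its terms \<open>w\<close>, and a
  block \<open>U2\<close> leaving that line on the line of a term \<open>z\<close> off it. The two are disjoint, and their
  union is a noncollinear block.
\<close>
lemma noncollinear_block:
  fixes Q :: "('p::prime_card mod_ring ^ 2) multiset"
  assumes Q: "0 \<notin># Q" "2 * CARD('p) - 1 \<le> size Q"
    and light: "\<And>l. l \<noteq> 0 \<Longrightarrow> size {#v \<in># Q. det2 l v = 0#} < CARD('p)"
  shows "\<exists>U. U \<subseteq># Q \<and> \<Sum>\<^sub># U = 0 \<and> noncollinear U"
proof (rule ccontr)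
  assume none: "\<not> ?thesis"
  have "2 \<le> CARD('p)" using prime_card[where 'a = 'p] by (rule prime_ge_2_nat)
  then obtain l where "l \<in># Q" using Q(2) by fastforce
  then have "l \<noteq> 0" using Q(1) by auto
  then obtain U1 w where U1: "U1 \<subseteq># Q" "\<Sum>\<^sub># U1 = 0" "w \<in># U1"
    using block_leaving_line[OF Q] light by metis
  then have w: "w \<noteq> 0" using Q(1) mset_subset_eqD by metis
  then obtain U2 z where U2: "U2 \<subseteq># Q" "\<Sum>\<^sub># U2 = 0" "z \<in># U2" "det2 w z \<noteq> 0"
    using block_leaving_line[OF Q] light by metis
  have on_w: "det2 w v = 0" if "v \<in># U1" for v
    using none U1 that unfolding noncollinear_def by blast
  have on_z: "det2 z v = 0" if "v \<in># U2" for v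
    using none U2 that unfolding noncollinear_def by blast
  have "U1 \<inter># U2 = {#}"
  proof (rule ccontr)
    assume "U1 \<inter># U2 \<noteq> {#}"
    then obtain v where "v \<in># U1 \<inter># U2" by blast
    then have v: "v \<in># U1" "v \<in># U2" by simp_all
    then have "v \<noteq> 0" using U1(1) Q(1) mset_subset_eqD by metis
    then show False
      using det2_trans[of v w z] on_w[OF v(1)] on_z[OF v(2)] det2_swap[of v w] det2_swap[of v z] U2(4)
      by simp
  qed
  then have "U1 + U2 \<subseteq># Q"
    using U1(1) U2(1) union_diff_inter_eq_sup[of U1 U2] by simp
  moreover have "\<Sum>\<^sub># (U1 + U2) = 0" using U1(2) U2(2) by simp
  moreover have "noncollinear (U1 + U2)"
    using U1(3) U2(3,4) by (intro noncollinearI[of w _ z]) auto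
  ultimately show False using none by blast
qed

text \<open>
  A noncollinear zero-sum block of greatest length is long enough: otherwise one of its terms \<open>u\<close>
  could be replaced by at least two terms from outside.
\<close>
lemma long_block_if_light_lines:
  fixes Q :: "('p::prime_card mod_ring ^ 2) multiset"
  assumes Q: "0 \<notin># Q" "size Q = 2 * CARD('p) + k - 2" and k: "1 \<le> k"
    and light: "\<And>l. l \<noteq> 0 \<Longrightarrow> size {#v \<in># Q. det2 l v = 0#} < CARD('p)"
  obtains U where "U \<subseteq># Q" and "\<Sum>\<^sub># U = 0" and "noncollinear U" and "k + 1 \<le> size U"
proof -
  let ?p = "CARD('p)"
  let ?block = "\<lambda>U. U \<subseteq># Q \<and> \<Sum>\<^sub># U = 0 \<and> noncollinear U"
  have p2: "2 \<le> ?p" using prime_card[where 'a = 'p] by (rule prime_ge_2_nat)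
  have "2 * ?p - 1 \<le> size Q" using Q(2) k p2 by linarith
  then obtain U0 where "?block U0" using noncollinear_block[OF Q(1) _ light] by blast
  moreover have "\<forall>U. ?block U \<longrightarrow> size U < size Q + 1"
    using size_mset_mono by (auto simp: less_Suc_eq_le)
  ultimately obtain U where U: "?block U" and max: "\<And>U'. ?block U' \<Longrightarrow> size U' \<le> size U"
    using ex_has_greatest_nat[of ?block U0 size "size Q + 1"] by (metis less_imp_le)
  have "k + 1 \<le> size U"
  proof (rule ccontr)
    assume short: "\<not> k + 1 \<le> size U"
    define V where "V = Q - U"
    have QUV: "Q = U + V" using U by (simp add: V_def)
    have zero_sum_free: "B = {#}" if "B \<subseteq># V" "\<Sum>\<^sub># B = 0" for B
    proof -
      have "?block (U + B)"
        using U that QUV noncollinear_mono[of U "U + B"] by simp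
      from max[OF this] show ?thesis by simp
    qed
    obtain u where u: "u \<in># U" using U by (auto simp: noncollinear_def)
    define U' where "U' = U - {#u#}"
    have U': "U = add_mset u U'" using u by (simp add: U'_def)
    have "noncollinear U'" using U u noncollinear_remove[of U u] by (simp add: U'_def)
    have u0: "u \<noteq> 0" using u Q(1) QUV by auto
    define V0 where "V0 = {#v \<in># V. det2 u v = 0#}"
    define S where "S = {#v \<in># V. det2 u v \<noteq> 0#}"
    have V: "V = V0 + S" unfolding V0_def S_def by (rule multiset_partition)
    have "{#v \<in># Q. det2 u v = 0#} = {#v \<in># U'. det2 u v = 0#} + add_mset u V0"
      by (simp add: QUV U' V0_def)
    then have size_T: "size (add_mset u V0) < ?p" using light[OF u0] by simp
    have "size Q = size U + (size V0 + size S)" using QUV V by simp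
    then have size_ST: "2 * ?p - 1 + 0 \<le> size S + size (add_mset u V0)"
      using short Q(2) k p2 by simp
    \<comment> \<open>Adding \<open>u\<close> to the terms of \<open>V\<close> on its own line supplies the one term that \<open>V\<close>, which may
      have only \<open>2 p - 2\<close> terms, can lack for the exchange lemma; \<open>u\<close> is also the subsequence to be exchanged.\<close>
    have "\<exists>W T'. W \<subseteq># S \<and> T' \<subseteq># add_mset u V0 \<and> 0 + 2 \<le> size W \<and> \<Sum>\<^sub># W + \<Sum>\<^sub># T' = \<Sum>\<^sub># {#u#}"
    proof (rule compensated_subsequence[of u S "add_mset u V0" "{#u#}" 0])
      show "0 \<notin># add_mset u V0" using u0 Q(1) QUV V by auto
    qed (use u0 size_T size_ST p2 in \<open>auto simp: S_def V0_def\<close>)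
    then obtain W T' where W: "W \<subseteq># S" "T' \<subseteq># add_mset u V0" "2 \<le> size W" "\<Sum>\<^sub># W + \<Sum>\<^sub># T' = u"
      by auto
    have "T' - {#u#} \<subseteq># V0" using W(2) by (simp add: subset_eq_diff_conv)
    then have "W + (T' - {#u#}) \<subseteq># S + V0" using W(1) by (rule subset_mset.add_mono[rotated])
    then have WV: "W + (T' - {#u#}) \<subseteq># V" by (simp only: V add.commute[of V0])
    show False
    proof (cases "u \<in># T'")
      case True
      \<comment> \<open>The extra copy of \<open>u\<close> cancels and leaves a zero-sum block inside \<open>V\<close>.\<close>
      then have "\<Sum>\<^sub># T' = u + \<Sum>\<^sub># (T' - {#u#})"
        using sum_mset.remove by fastforce
      then have "u + (\<Sum>\<^sub># W + \<Sum>\<^sub># (T' - {#u#})) = u" using W(4) by (simp add: add_ac)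
      then have "\<Sum>\<^sub># (W + (T' - {#u#})) = 0" by simp
      then show False using zero_sum_free[OF WV] W(3) by auto
    next
      case False
      \<comment> \<open>Now \<open>W + T'\<close> has sum \<open>u\<close>, lies in \<open>V\<close> and has at least two terms.\<close>
      then have "W + T' \<subseteq># V" using WV by (simp add: diff_single_trivial)
      then have "U' + (W + T') \<subseteq># U' + V" by simp
      also have "\<dots> \<subseteq># Q" using U' by (simp add: QUV)
      finally have "U' + (W + T') \<subseteq># Q" .
      moreover have "\<Sum>\<^sub># (U' + (W + T')) = 0" using W(4) U U' by (simp add: add.commute)
      moreover have "noncollinear (U' + (W + T'))"
        using \<open>noncollinear U'\<close> noncollinear_mono by (metis mset_subset_eq_add_left)
      ultimately have "size (U' + (W + T')) \<le> size U" using max by blast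
      then show False using W(3) U' by simp
    qed
  qed
  then show thesis using that U by blast
qed

theorem theorem5p1:
  fixes p k :: nat
    and Q :: "('p::prime_card mod_ring ^ 2) multiset"
  assumes "CARD('p) = p" and "prime p" and "odd p"
    and "1 \<le> k" and "k \<le> p"
    and "0 \<notin># Q"
    and "size Q = 2 * p + k - 2"
    and "\<And>L. is_line L \<Longrightarrow> size (restrict_seq Q L) \<le> p + k - 2"
  shows "\<exists>U. zero_sum_block Q U \<and> mixed_seq U \<and> card (Omega U) \<ge> k"
proof -
  have size_Q: "size Q = 2 * CARD('p) + k - 2" and k: "k \<le> CARD('p)" using assms by simp_all
  obtain U where U: "U \<subseteq># Q" "\<Sum>\<^sub># U = 0" "noncollinear U" "k + 1 \<le> size U"
  proof (cases "\<exists>l. l \<noteq> 0 \<and> CARD('p) \<le> size {#v \<in># Q. det2 l v = 0#}")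
    case True
    then obtain l where l: "l \<noteq> 0" "CARD('p) \<le> size {#v \<in># Q. det2 l v = 0#}" by blast
    then have "is_line {v. det2 l v = 0}" by (auto simp: is_line_iff)
    then have "size {#v \<in># Q. det2 l v = 0#} \<le> CARD('p) + k - 2"
      using assms(1,8) by (force simp: restrict_seq_def)
    then show thesis
      using long_block_if_heavy_line[OF assms(6) size_Q k l] that by blast
  next
    case False
    then show thesis
      using long_block_if_light_lines[OF assms(6) size_Q assms(4)] that by (metis not_less)
  qed
  have U0: "0 \<notin># U" using U(1) assms(6) mset_subset_eqD by metis
  have "zero_sum_block Q U" using U by (auto simp: zero_sum_block_def)
  moreover have "mixed_seq U" using mixed_seq_iff[OF U0] U(3) by simp
  moreover have "card (Omega U) \<ge> k"
    using card_Omega_zero_sum[OF U(3) U0 U(2)] U(4) k by simp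
  ultimately show ?thesis by blast
qed

end
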